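(* Let $(A,\cdot,\alpha)$ be a Hom-associative algebra, let $(V,l,r,\beta)$ be a bimodule of $A$, and let $\mathcal K:V\to A$ be a relative averaging operator on $A$ with respect to $(V,l,r,\beta)$. Then $\mathcal K$ is a relative averaging operator on the associated Hom-Jordan algebra $(A,\circ,\alpha)$, where $x\circ y=x\cdot y+y\cdot x$, with respect to the $(A,\circ,\alpha)$-module $(V,\pi=l+r,\beta)$. Moreover, let $(V,\vdash,\dashv,\beta)$ be the Hom-associative dialgebra given by $u\vdash v=l(\mathcal K(u))v$ and $u\dashv v=r(\mathcal K(v))u$; then the anti-dicommutator $u\bullet v=u\vdash v+v\dashv u$ makes $V$, with twisting map $\beta$, into a Hom-Jordan dialgebra.
   Context: All vector spaces are over a field $\mathbb K$ of characteristic $0$. All Hom-algebras are multiplicative, i.e. the twisting map preserves every bilinear operation of the structure. A Hom-associative algebra $(A,\cdot,\alpha)$ is a vector space $A$ with a bilinear operation $\cdot$ and a linear map $\alpha:A\to A$ such that $(x\cdot y)\cdot\alpha(z)=\alpha(x)\cdot(y\cdot z)$ for all $x,y,z\in A$. A bimodule $(V,l,r,\beta)$ of $(A,\cdot,\alpha)$ is a vector space $V$ with a linear map $\beta:V\to V$ and linear maps $l,r:A\to \mathrm{End}(V)$ such that for all $x,y\in A$: $\beta l(x)=l(\alpha(x))\beta$, $\beta r(x)=r(\alpha(x))\beta$, $l(x\cdot y)\beta=l(\alpha(x))l(y)$, $r(x\cdot y)\beta=r(\alpha(y))r(x)$, $l(\alpha(x))r(y)=r(\alpha(y))l(x)$.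 A linear map $\mathcal K:V\to A$ is a relative averaging operator on the Hom-associative algebra $A$ with respect to $(V,l,r,\beta)$ if $\mathcal K\beta=\alpha\mathcal K$ and $\mathcal K(u)\cdot\mathcal K(v)=\mathcal K(l(\mathcal K(u))v)=\mathcal K(r(\mathcal K(v))u)$ for all $u,v\in V$. A Hom-associative dialgebra $(D,\vdash,\dashv,\alpha)$ is a vector space with bilinear operations $\vdash,\dashv$ and a linear map $\alpha$ such that for all $x,y,z$: $(x\dashv y)\vdash\alpha(z)=(x\vdash y)\vdash\alpha(z)$; $\alpha(x)\dashv(y\dashv z)=\alpha(x)\dashv(y\vdash z)$; $(x\dashv y)\dashv\alpha(z)=\alpha(x)\dashv(y\dashv z)$; $(x\vdash y)\vdash\alpha(z)=\alpha(x)\vdash(y\vdash z)$; $(x\vdash y)\dashv\alpha(z)=\alpha(x)\vdash(y\dashv z)$. A Hom-Jordan algebra $(A,\circ,\alpha)$ is a vector space with a bilinear operation $\circ$ and a linear map $\alpha$ such that $x\circ y=y\circ x$ and $\alpha(x^2)\circ(\alpha(y)\circ\alpha(x))=(x^2\circ\alpha(y))\circ\alpha^2(x)$, where $x^2=x\circ x$. A module (representation) $(V,\pi,\beta)$ of a Hom-Jordan algebra $(A,\circ,\alpha)$ is a vector space $V$ with a linear map $\beta:V\to V$ and a linear map $\pi:A\to \mathrm{End}(V)$ such that for all $x,y,z\in A$: $\beta\pi(x)=\pi(\alpha(x))\beta$; $\pi(\alpha^2(x))\pi(y\circ z)\beta+\pi(\alpha^2(y))\pi(z\circ x)\beta+\pi(\alpha^2(z))\pi(x\circ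 y)\beta=\pi(\alpha(x)\circ\alpha(y))\pi(\alpha(z))\beta+\pi(\alpha(y)\circ\alpha(z))\pi(\alpha(x))\beta+\pi(\alpha(z)\circ\alpha(x))\pi(\alpha(y))\beta$; $\pi((x\circ y)\circ\alpha(z))\beta^2+\pi(\alpha^2(x))\pi(\alpha(z))\pi(y)+\pi(\alpha^2(y))\pi(\alpha(z))\pi(x)=\pi(\alpha(x)\circ\alpha(y))\pi(\alpha(z))\beta+\pi(\alpha(y)\circ\alpha(z))\pi(\alpha(x))\beta+\pi(\alpha(x)\circ\alpha(z))\pi(\alpha(y))\beta$. A linear map $\mathcal K:V\to A$ is a relative averaging operator on the Hom-Jordan algebra $A$ with respect to $(V,\pi,\beta)$ if $\mathcal K\beta=\alpha\mathcal K$ and $\mathcal K(u)\circ\mathcal K(v)=\mathcal K(\pi(\mathcal K(u))v)$ for all $u,v\in V$. A (left) Hom-Jordan dialgebra $(D,\bullet,\alpha)$ is a vector space with a bilinear operation $\bullet$ and a linear map $\alpha$ such that for all $x_1,x_2,x_3,x_4\in D$: (a) $(x_1\bullet x_2)\bullet x_3=(x_2\bullet x_1)\bullet x_3$; (b) $((x_4\bullet x_3)\bullet\alpha(x_2))\bullet\alpha^2(x_1)+\alpha^2(x_4)\bullet(\alpha(x_2)\bullet(x_3\bullet x_1))+\alpha^2(x_3)\bullet(\alpha(x_2)\bullet(x_4\bullet x_1))=\alpha(x_4\bullet x_3)\bullet(\alpha(x_2)\bullet\alpha(x_1))+(\alpha(x_4)\bullet\alpha(x_2))\bullet\alpha(x_3\bullet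 x_1)+(\alpha(x_3)\bullet\alpha(x_2))\bullet\alpha(x_4\bullet x_1)$; (c) $\alpha^2(x_1)\bullet((x_4\bullet x_3)\bullet\alpha(x_2))+\alpha^2(x_4)\bullet((x_3\bullet x_1)\bullet\alpha(x_2))+\alpha^2(x_3)\bullet((x_4\bullet x_1)\bullet\alpha(x_2))=\alpha(x_4\bullet x_3)\bullet(\alpha(x_1)\bullet\alpha(x_2))+\alpha(x_1\bullet x_3)\bullet(\alpha(x_4)\bullet\alpha(x_2))+\alpha(x_4\bullet x_1)\bullet(\alpha(x_3)\bullet\alpha(x_2))$. *)

theory Defs
  imports Complex_Main
begin

(* A vector space is a type of class ab_group_add together with a scalar multiplication by a
   field of characteristic 0 (locale vector_space); maps are linear in the sense of
   Vector_Spaces.linear, which includes that its domain and codomain are vector spaces. *)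

definition bilinear_map ::
  "('k::field_char_0 \<Rightarrow> 'a::ab_group_add \<Rightarrow> 'a) \<Rightarrow> ('k \<Rightarrow> 'b::ab_group_add \<Rightarrow> 'b) \<Rightarrow>
   ('k \<Rightarrow> 'c::ab_group_add \<Rightarrow> 'c) \<Rightarrow> ('a \<Rightarrow> 'b \<Rightarrow> 'c) \<Rightarrow> bool"
  where "bilinear_map s1 s2 s3 f \<longleftrightarrow>
    (\<forall>x. Vector_Spaces.linear s2 s3 (\<lambda>y. f x y)) \<and> (\<forall>y. Vector_Spaces.linear s1 s3 (\<lambda>x. f x y))"

locale hom_associative_algebra =
  fixes scale :: "'k::field_char_0 \<Rightarrow> 'a::ab_group_add \<Rightarrow> 'a"
    and mul :: "'a \<Rightarrow> 'a \<Rightarrow> 'a"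
    and \<alpha> :: "'a \<Rightarrow> 'a"
  assumes bilinear_mul: "bilinear_map scale scale scale mul"
    and linear_twist: "Vector_Spaces.linear scale scale \<alpha>"
    and multiplicative: "\<alpha> (mul x y) = mul (\<alpha> x) (\<alpha> y)"
    and hom_assoc: "mul (mul x y) (\<alpha> z) = mul (\<alpha> x) (mul y z)"

(* A linear map from A to End(V) is encoded in curried form, as a map linear in each of its two
   arguments (A first, V second). *)

locale hom_associative_bimodule = hom_associative_algebra scaleA mul \<alpha>
  for scaleA :: "'k::field_char_0 \<Rightarrow> 'a::ab_group_add \<Rightarrow> 'a"
    and mul :: "'a \<Rightarrow> 'a \<Rightarrow> 'a"
    and \<alpha> :: "'a \<Rightarrow> 'a" +
  fixes scaleV :: "'k \<Rightarrow> 'v::ab_group_add \<Rightarrow> 'v"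
    and l :: "'a \<Rightarrow> 'v \<Rightarrow> 'v"
    and r :: "'a \<Rightarrow> 'v \<Rightarrow> 'v"
    and \<beta> :: "'v \<Rightarrow> 'v"
  assumes linear_beta: "Vector_Spaces.linear scaleV scaleV \<beta>"
    and bilinear_l: "bilinear_map scaleA scaleV scaleV l"
    and bilinear_r: "bilinear_map scaleA scaleV scaleV r"
    and beta_l: "\<beta> (l x v) = l (\<alpha> x) (\<beta> v)"
    and beta_r: "\<beta> (r x v) = r (\<alpha> x) (\<beta> v)"
    and l_mul: "l (mul x y) (\<beta> v) = l (\<alpha> x) (l y v)"
    and r_mul: "r (mul x y) (\<beta> v) = r (\<alpha> y) (r x v)"
    and l_r: "l (\<alpha> x) (r y v) = r (\<alpha> y) (l x v)"

locale hom_associative_relative_averaging = hom_associative_bimodule scaleA mul \<alpha> scaleV l r \<beta>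
  for scaleA :: "'k::field_char_0 \<Rightarrow> 'a::ab_group_add \<Rightarrow> 'a"
    and mul :: "'a \<Rightarrow> 'a \<Rightarrow> 'a"
    and \<alpha> :: "'a \<Rightarrow> 'a"
    and scaleV :: "'k \<Rightarrow> 'v::ab_group_add \<Rightarrow> 'v"
    and l :: "'a \<Rightarrow> 'v \<Rightarrow> 'v"
    and r :: "'a \<Rightarrow> 'v \<Rightarrow> 'v"
    and \<beta> :: "'v \<Rightarrow> 'v" +
  fixes K :: "'v \<Rightarrow> 'a"
  assumes linear_K: "Vector_Spaces.linear scaleV scaleA K"
    and K_beta: "K (\<beta> u) = \<alpha> (K u)"
    and K_averaging_l: "mul (K u) (K v) = K (l (K u) v)"
    and K_averaging_r: "mul (K u) (K v) = K (r (K v) u)"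

locale hom_associative_dialgebra =
  fixes scale :: "'k::field_char_0 \<Rightarrow> 'd::ab_group_add \<Rightarrow> 'd"
    and vd :: "'d \<Rightarrow> 'd \<Rightarrow> 'd"  (infixl "\<turnstile>\<^sub>d" 70)
    and dv :: "'d \<Rightarrow> 'd \<Rightarrow> 'd"  (infixl "\<stileturn>\<^sub>d" 70)
    and \<alpha> :: "'d \<Rightarrow> 'd"
  assumes bilinear_vd: "bilinear_map scale scale scale vd"
    and bilinear_dv: "bilinear_map scale scale scale dv"
    and linear_twist: "Vector_Spaces.linear scale scale \<alpha>"
    and multiplicative_vd: "\<alpha> (x \<turnstile>\<^sub>d y) = \<alpha> x \<turnstile>\<^sub>d \<alpha> y"
    and multiplicative_dv: "\<alpha> (x \<stileturn>\<^sub>d y) = \<alpha> x \<stileturn>\<^sub>d \<alpha> y"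
    and dialgebra_1: "(x \<stileturn>\<^sub>d y) \<turnstile>\<^sub>d \<alpha> z = (x \<turnstile>\<^sub>d y) \<turnstile>\<^sub>d \<alpha> z"
    and dialgebra_2: "\<alpha> x \<stileturn>\<^sub>d (y \<stileturn>\<^sub>d z) = \<alpha> x \<stileturn>\<^sub>d (y \<turnstile>\<^sub>d z)"
    and dialgebra_3: "(x \<stileturn>\<^sub>d y) \<stileturn>\<^sub>d \<alpha> z = \<alpha> x \<stileturn>\<^sub>d (y \<stileturn>\<^sub>d z)"
    and dialgebra_4: "(x \<turnstile>\<^sub>d y) \<turnstile>\<^sub>d \<alpha> z = \<alpha> x \<turnstile>\<^sub>d (y \<turnstile>\<^sub>d z)"
    and dialgebra_5: "(x \<turnstile>\<^sub>d y) \<stileturn>\<^sub>d \<alpha> z = \<alpha> x \<turnstile>\<^sub>d (y \<stileturn>\<^sub>d z)"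

locale hom_jordan_algebra =
  fixes scale :: "'k::field_char_0 \<Rightarrow> 'a::ab_group_add \<Rightarrow> 'a"
    and jmul :: "'a \<Rightarrow> 'a \<Rightarrow> 'a"  (infixl "\<circ>\<^sub>j" 70)
    and \<alpha> :: "'a \<Rightarrow> 'a"
  assumes bilinear_jmul: "bilinear_map scale scale scale jmul"
    and linear_twist: "Vector_Spaces.linear scale scale \<alpha>"
    and multiplicative: "\<alpha> (x \<circ>\<^sub>j y) = \<alpha> x \<circ>\<^sub>j \<alpha> y"
    and jmul_commute: "x \<circ>\<^sub>j y = y \<circ>\<^sub>j x"
    and hom_jordan: "\<alpha> (x \<circ>\<^sub>j x) \<circ>\<^sub>j (\<alpha> y \<circ>\<^sub>j \<alpha> x) = ((x \<circ>\<^sub>j x) \<circ>\<^sub>j \<alpha> y) \<circ>\<^sub>j \<alpha> (\<alpha> x)"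

locale hom_jordan_module = hom_jordan_algebra scaleA jmul \<alpha>
  for scaleA :: "'k::field_char_0 \<Rightarrow> 'a::ab_group_add \<Rightarrow> 'a"
    and jmul :: "'a \<Rightarrow> 'a \<Rightarrow> 'a"  (infixl "\<circ>\<^sub>j" 70)
    and \<alpha> :: "'a \<Rightarrow> 'a" +
  fixes scaleV :: "'k \<Rightarrow> 'v::ab_group_add \<Rightarrow> 'v"
    and \<pi> :: "'a \<Rightarrow> 'v \<Rightarrow> 'v"
    and \<beta> :: "'v \<Rightarrow> 'v"
  assumes linear_beta: "Vector_Spaces.linear scaleV scaleV \<beta>"
    and bilinear_pi: "bilinear_map scaleA scaleV scaleV \<pi>"
    and beta_pi: "\<beta> (\<pi> x v) = \<pi> (\<alpha> x) (\<beta> v)"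
    and module_cyclic:
      "\<pi> (\<alpha> (\<alpha> x)) (\<pi> (y \<circ>\<^sub>j z) (\<beta> v)) + \<pi> (\<alpha> (\<alpha> y)) (\<pi> (z \<circ>\<^sub>j x) (\<beta> v))
        + \<pi> (\<alpha> (\<alpha> z)) (\<pi> (x \<circ>\<^sub>j y) (\<beta> v))
       = \<pi> (\<alpha> x \<circ>\<^sub>j \<alpha> y) (\<pi> (\<alpha> z) (\<beta> v)) + \<pi> (\<alpha> y \<circ>\<^sub>j \<alpha> z) (\<pi> (\<alpha> x) (\<beta> v))
        + \<pi> (\<alpha> z \<circ>\<^sub>j \<alpha> x) (\<pi> (\<alpha> y) (\<beta> v))"
    and module_product:
      "\<pi> ((x \<circ>\<^sub>j y) \<circ>\<^sub>j \<alpha> z) (\<beta> (\<beta> v)) + \<pi> (\<alpha> (\<alpha> x)) (\<pi> (\<alpha> z) (\<pi> y v))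
        + \<pi> (\<alpha> (\<alpha> y)) (\<pi> (\<alpha> z) (\<pi> x v))
       = \<pi> (\<alpha> x \<circ>\<^sub>j \<alpha> y) (\<pi> (\<alpha> z) (\<beta> v)) + \<pi> (\<alpha> y \<circ>\<^sub>j \<alpha> z) (\<pi> (\<alpha> x) (\<beta> v))
        + \<pi> (\<alpha> x \<circ>\<^sub>j \<alpha> z) (\<pi> (\<alpha> y) (\<beta> v))"

locale hom_jordan_relative_averaging = hom_jordan_module scaleA jmul \<alpha> scaleV \<pi> \<beta>
  for scaleA :: "'k::field_char_0 \<Rightarrow> 'a::ab_group_add \<Rightarrow> 'a"
    and jmul :: "'a \<Rightarrow> 'a \<Rightarrow> 'a"  (infixl "\<circ>\<^sub>j" 70)
    and \<alpha> :: "'a \<Rightarrow> 'a"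
    and scaleV :: "'k \<Rightarrow> 'v::ab_group_add \<Rightarrow> 'v"
    and \<pi> :: "'a \<Rightarrow> 'v \<Rightarrow> 'v"
    and \<beta> :: "'v \<Rightarrow> 'v" +
  fixes K :: "'v \<Rightarrow> 'a"
  assumes linear_K: "Vector_Spaces.linear scaleV scaleA K"
    and K_beta: "K (\<beta> u) = \<alpha> (K u)"
    and K_averaging: "K u \<circ>\<^sub>j K v = K (\<pi> (K u) v)"

locale hom_jordan_dialgebra =
  fixes scale :: "'k::field_char_0 \<Rightarrow> 'd::ab_group_add \<Rightarrow> 'd"
    and bul :: "'d \<Rightarrow> 'd \<Rightarrow> 'd"  (infixl "\<bullet>\<^sub>d" 70)
    and \<alpha> :: "'d \<Rightarrow> 'd"
  assumes bilinear_bul: "bilinear_map scale scale scale bul"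
    and linear_twist: "Vector_Spaces.linear scale scale \<alpha>"
    and multiplicative: "\<alpha> (x \<bullet>\<^sub>d y) = \<alpha> x \<bullet>\<^sub>d \<alpha> y"
    and left_commute: "(x1 \<bullet>\<^sub>d x2) \<bullet>\<^sub>d x3 = (x2 \<bullet>\<^sub>d x1) \<bullet>\<^sub>d x3"
    and dialgebra_product:
      "((x4 \<bullet>\<^sub>d x3) \<bullet>\<^sub>d \<alpha> x2) \<bullet>\<^sub>d \<alpha> (\<alpha> x1) + \<alpha> (\<alpha> x4) \<bullet>\<^sub>d (\<alpha> x2 \<bullet>\<^sub>d (x3 \<bullet>\<^sub>d x1))
        + \<alpha> (\<alpha> x3) \<bullet>\<^sub>d (\<alpha> x2 \<bullet>\<^sub>d (x4 \<bullet>\<^sub>d x1))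
       = \<alpha> (x4 \<bullet>\<^sub>d x3) \<bullet>\<^sub>d (\<alpha> x2 \<bullet>\<^sub>d \<alpha> x1) + (\<alpha> x4 \<bullet>\<^sub>d \<alpha> x2) \<bullet>\<^sub>d \<alpha> (x3 \<bullet>\<^sub>d x1)
        + (\<alpha> x3 \<bullet>\<^sub>d \<alpha> x2) \<bullet>\<^sub>d \<alpha> (x4 \<bullet>\<^sub>d x1)"
    and dialgebra_cyclic:
      "\<alpha> (\<alpha> x1) \<bullet>\<^sub>d ((x4 \<bullet>\<^sub>d x3) \<bullet>\<^sub>d \<alpha> x2) + \<alpha> (\<alpha> x4) \<bullet>\<^sub>d ((x3 \<bullet>\<^sub>d x1) \<bullet>\<^sub>d \<alpha> x2)
        + \<alpha> (\<alpha> x3) \<bullet>\<^sub>d ((x4 \<bullet>\<^sub>d x1) \<bullet>\<^sub>d \<alpha> x2)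
       = \<alpha> (x4 \<bullet>\<^sub>d x3) \<bullet>\<^sub>d (\<alpha> x1 \<bullet>\<^sub>d \<alpha> x2) + \<alpha> (x1 \<bullet>\<^sub>d x3) \<bullet>\<^sub>d (\<alpha> x4 \<bullet>\<^sub>d \<alpha> x2)
        + \<alpha> (x4 \<bullet>\<^sub>d x1) \<bullet>\<^sub>d (\<alpha> x3 \<bullet>\<^sub>d \<alpha> x2)"

definition jordan_product :: "('a \<Rightarrow> 'a \<Rightarrow> 'a::ab_group_add) \<Rightarrow> 'a \<Rightarrow> 'a \<Rightarrow> 'a"
  where "jordan_product mul x y = mul x y + mul y x"

definition averaging_vd :: "('a \<Rightarrow> 'v \<Rightarrow> 'v) \<Rightarrow> ('v \<Rightarrow> 'a) \<Rightarrow> 'v \<Rightarrow> 'v \<Rightarrow> 'v"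
  where "averaging_vd l K u v = l (K u) v"

definition averaging_dv :: "('a \<Rightarrow> 'v \<Rightarrow> 'v) \<Rightarrow> ('v \<Rightarrow> 'a) \<Rightarrow> 'v \<Rightarrow> 'v \<Rightarrow> 'v"
  where "averaging_dv r K u v = r (K v) u"

definition anti_dicommutator ::
  "('d \<Rightarrow> 'd \<Rightarrow> 'd) \<Rightarrow> ('d \<Rightarrow> 'd \<Rightarrow> 'd) \<Rightarrow> 'd \<Rightarrow> 'd \<Rightarrow> 'd::ab_group_add"
  where "anti_dicommutator vd dv u v = vd u v + dv v u"

end

theory Submission
  imports Defs
begin

text \<open>
  Every identity in question is, after expansion of the symmetrised actions, an equality between two
  sums of twisted words in which a vector \<open>v\<close> is surrounded by letters from \<open>A\<close>. In a bimodule
  such a word depends only on the order of its letters: two letters acting from the same side can be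
  fused or split, and a left letter commutes with a right one, always at the cost of the twists that
  the position dictates. For \<open>\<pi> = l + r\<close>, each side of each of the two module axioms is the sum of
  all 24 words with the letters \<open>x, y, z\<close> in any order and \<open>v\<close> in any of the four slots. The Jordan identity of
  \<open>A\<close> is verified in the same manner by regrouping fourfold products.

  The averaging conditions for \<open>l\<close> and \<open>r\<close> add up to the one for \<open>\<pi>\<close>. The statement on dialgebras
  is then an instance of a purely Jordan fact: for any relative averaging operator \<open>K\<close> on a
  Hom-Jordan algebra, \<open>u \<bullet> v = \<pi> (K u) v\<close> is a Hom-Jordan dialgebra product. Indeed
  \<open>K (u \<bullet> v) = K u \<circ> K v\<close>, so the three dialgebra identities are the commutativity of \<open>\<circ>\<close> and
  the two module axioms evaluated at letters in the image of \<open>K\<close>. The anti-dicommutator of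
  \<open>\<turnstile>\<close> and \<open>\<stileturn>\<close> is precisely this product.
\<close>

lemma bilinear_mapD:
  assumes "bilinear_map s1 s2 s3 f"
  shows "f (x + x') y = f x y + f x' y"
    and "f x (y + y') = f x y + f x y'"
proof -
  have "Vector_Spaces.linear s1 s3 (\<lambda>x. f x y)" and "Vector_Spaces.linear s2 s3 (\<lambda>y. f x y)"
    using assms by (simp_all add: bilinear_map_def)
  then show "f (x + x') y = f x y + f x' y" and "f x (y + y') = f x y + f x y'"
    by (simp_all add: Vector_Spaces.linear_iff)
qed

lemma bilinear_map_add:
  assumes "bilinear_map s1 s2 s3 f" and "bilinear_map s1 s2 s3 g"
  shows "bilinear_map s1 s2 s3 (\<lambda>x y. f x y + g x y)"
  using assms
  by (simp add: bilinear_map_def Vector_Spaces.linear_iff vector_space.vector_space_assms(1)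
      algebra_simps)

lemma bilinear_map_flip:
  assumes "bilinear_map s1 s2 s3 f"
  shows "bilinear_map s2 s1 s3 (\<lambda>x y. f y x)"
  using assms by (simp add: bilinear_map_def)

lemma bilinear_map_compose_left:
  assumes "bilinear_map s1 s2 s3 f" and "Vector_Spaces.linear s0 s1 g"
  shows "bilinear_map s0 s2 s3 (\<lambda>x y. f (g x) y)"
  using assms by (simp add: bilinear_map_def Vector_Spaces.linear_iff)

lemma (in hom_associative_algebra) hom_jordan_algebra_jordan_product:
  "hom_jordan_algebra scale (jordan_product mul) \<alpha>"
proof (rule hom_jordan_algebra.intro)
  show "bilinear_map scale scale scale (jordan_product mul)"
    using bilinear_map_add[OF bilinear_mul bilinear_map_flip[OF bilinear_mul]]
    by (simp add: jordan_product_def[abs_def])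
  show "Vector_Spaces.linear scale scale \<alpha>"
    by (rule linear_twist)
  have \<alpha>_add: "\<alpha> (x + y) = \<alpha> x + \<alpha> y" for x y
    using linear_twist by (simp add: Vector_Spaces.linear_iff)
  show "\<alpha> (jordan_product mul x y) = jordan_product mul (\<alpha> x) (\<alpha> y)" for x y
    by (simp add: jordan_product_def \<alpha>_add multiplicative)
  show "jordan_product mul x y = jordan_product mul y x" for x y
    by (simp add: jordan_product_def add.commute)
  show "jordan_product mul (\<alpha> (jordan_product mul x x)) (jordan_product mul (\<alpha> y) (\<alpha> x))
      = jordan_product mul (jordan_product mul (jordan_product mul x x) (\<alpha> y)) (\<alpha> (\<alpha> x))" for x y
  proof -
    \<comment> \<open>Each of the four words \<open>xxyx\<close>, \<open>xxxy\<close>, \<open>yxxx\<close>, \<open>xyxx\<close> is rebracketed from the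
      nested form on the right-hand side to the product of two pairs on the left-hand side.\<close>
    let ?q = "mul x x"
    have xxyx: "mul (mul ?q (\<alpha> y)) (\<alpha> (\<alpha> x)) = mul (\<alpha> ?q) (mul (\<alpha> y) (\<alpha> x))"
      by (rule hom_assoc)
    have yxxx: "mul (mul (\<alpha> y) ?q) (\<alpha> (\<alpha> x)) = mul (mul (\<alpha> y) (\<alpha> x)) (\<alpha> ?q)"
      by (simp add: hom_assoc)
    have xxxy: "mul (\<alpha> (\<alpha> x)) (mul ?q (\<alpha> y)) = mul (\<alpha> ?q) (mul (\<alpha> x) (\<alpha> y))"
      by (simp flip: hom_assoc)
    have xyxx: "mul (\<alpha> (\<alpha> x)) (mul (\<alpha> y) ?q) = mul (mul (\<alpha> x) (\<alpha> y)) (\<alpha> ?q)"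
      by (rule hom_assoc[symmetric])
    show ?thesis
      by (simp add: jordan_product_def \<alpha>_add bilinear_mapD[OF bilinear_mul] xxyx yxxx xxxy xyxx
          add_ac)
  qed
qed

text \<open>
  The equations \<open>word_simps\<close> below bring a twisted word with three letters into a normal form
  determined by the order of its letters and the position of \<open>v\<close>: occurrences of \<open>\<beta>\<close> are
  moved outwards until they are absorbed in splitting a product, and right letters are applied after
  left ones. Both module axioms are then equalities of sums up to permutation of summands.
\<close>

lemma (in hom_associative_bimodule) hom_jordan_module_symmetrised_action:
  "hom_jordan_module scaleA (jordan_product mul) \<alpha> scaleV (\<lambda>x v. l x v + r x v) \<beta>"
proof (intro hom_jordan_module.intro hom_jordan_module_axioms.intro)
  show "hom_jordan_algebra scaleA (jordan_product mul) \<alpha>"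
    by (rule hom_jordan_algebra_jordan_product)
  show "Vector_Spaces.linear scaleV scaleV \<beta>"
    by (rule linear_beta)
  show "bilinear_map scaleA scaleV scaleV (\<lambda>x v. l x v + r x v)"
    using bilinear_l bilinear_r by (rule bilinear_map_add)
  have \<beta>_add: "\<beta> (u + v) = \<beta> u + \<beta> v" for u v
    using linear_beta by (simp add: Vector_Spaces.linear_iff)
  show "\<beta> (l x v + r x v) = l (\<alpha> x) (\<beta> v) + r (\<alpha> x) (\<beta> v)" for x v
    by (simp add: \<beta>_add beta_l beta_r)
  note additive = jordan_product_def bilinear_mapD[OF bilinear_l] bilinear_mapD[OF bilinear_r]
    bilinear_mapD[OF bilinear_mul]
  note word_simps = beta_l[symmetric] beta_r[symmetric] multiplicative l_mul r_mul l_r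
  fix x y z v
  show "l (\<alpha> (\<alpha> x)) (l (jordan_product mul y z) (\<beta> v) + r (jordan_product mul y z) (\<beta> v))
      + r (\<alpha> (\<alpha> x)) (l (jordan_product mul y z) (\<beta> v) + r (jordan_product mul y z) (\<beta> v))
      + (l (\<alpha> (\<alpha> y)) (l (jordan_product mul z x) (\<beta> v) + r (jordan_product mul z x) (\<beta> v))
      + r (\<alpha> (\<alpha> y)) (l (jordan_product mul z x) (\<beta> v) + r (jordan_product mul z x) (\<beta> v)))
      + (l (\<alpha> (\<alpha> z)) (l (jordan_product mul x y) (\<beta> v) + r (jordan_product mul x y) (\<beta> v))
      + r (\<alpha> (\<alpha> z)) (l (jordan_product mul x y) (\<beta> v) + r (jordan_product mul x y) (\<beta> v)))
    = l (jordan_product mul (\<alpha> x) (\<alpha> y)) (l (\<alpha> z) (\<beta> v) + r (\<alpha> z) (\<beta> v))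
      + r (jordan_product mul (\<alpha> x) (\<alpha> y)) (l (\<alpha> z) (\<beta> v) + r (\<alpha> z) (\<beta> v))
      + (l (jordan_product mul (\<alpha> y) (\<alpha> z)) (l (\<alpha> x) (\<beta> v) + r (\<alpha> x) (\<beta> v))
      + r (jordan_product mul (\<alpha> y) (\<alpha> z)) (l (\<alpha> x) (\<beta> v) + r (\<alpha> x) (\<beta> v)))
      + (l (jordan_product mul (\<alpha> z) (\<alpha> x)) (l (\<alpha> y) (\<beta> v) + r (\<alpha> y) (\<beta> v))
      + r (jordan_product mul (\<alpha> z) (\<alpha> x)) (l (\<alpha> y) (\<beta> v) + r (\<alpha> y) (\<beta> v)))"
    by (simp add: additive word_simps add_ac)
  show "l (jordan_product mul (jordan_product mul x y) (\<alpha> z)) (\<beta> (\<beta> v))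
      + r (jordan_product mul (jordan_product mul x y) (\<alpha> z)) (\<beta> (\<beta> v))
      + (l (\<alpha> (\<alpha> x)) (l (\<alpha> z) (l y v + r y v) + r (\<alpha> z) (l y v + r y v))
      + r (\<alpha> (\<alpha> x)) (l (\<alpha> z) (l y v + r y v) + r (\<alpha> z) (l y v + r y v)))
      + (l (\<alpha> (\<alpha> y)) (l (\<alpha> z) (l x v + r x v) + r (\<alpha> z) (l x v + r x v))
      + r (\<alpha> (\<alpha> y)) (l (\<alpha> z) (l x v + r x v) + r (\<alpha> z) (l x v + r x v)))
    = l (jordan_product mul (\<alpha> x) (\<alpha> y)) (l (\<alpha> z) (\<beta> v) + r (\<alpha> z) (\<beta> v))
      + r (jordan_product mul (\<alpha> x) (\<alpha> y)) (l (\<alpha> z) (\<beta> v) + r (\<alpha> z) (\<beta> v))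
      + (l (jordan_product mul (\<alpha> y) (\<alpha> z)) (l (\<alpha> x) (\<beta> v) + r (\<alpha> x) (\<beta> v))
      + r (jordan_product mul (\<alpha> y) (\<alpha> z)) (l (\<alpha> x) (\<beta> v) + r (\<alpha> x) (\<beta> v)))
      + (l (jordan_product mul (\<alpha> x) (\<alpha> z)) (l (\<alpha> y) (\<beta> v) + r (\<alpha> y) (\<beta> v))
      + r (jordan_product mul (\<alpha> x) (\<alpha> z)) (l (\<alpha> y) (\<beta> v) + r (\<alpha> y) (\<beta> v)))"
    by (simp add: additive word_simps add_ac)
qed

lemma (in hom_associative_relative_averaging) hom_jordan_relative_averaging_symmetrised_action:
  "hom_jordan_relative_averaging scaleA (jordan_product mul) \<alpha> scaleV (\<lambda>x v. l x v + r x v) \<beta> K"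
proof (intro hom_jordan_relative_averaging.intro hom_jordan_relative_averaging_axioms.intro)
  show "hom_jordan_module scaleA (jordan_product mul) \<alpha> scaleV (\<lambda>x v. l x v + r x v) \<beta>"
    by (rule hom_jordan_module_symmetrised_action)
  show "Vector_Spaces.linear scaleV scaleA K"
    by (rule linear_K)
  show "K (\<beta> u) = \<alpha> (K u)" for u
    by (rule K_beta)
  have "K (u + v) = K u + K v" for u v
    using linear_K by (simp add: Vector_Spaces.linear_iff)
  then show "jordan_product mul (K u) (K v) = K (l (K u) v + r (K u) v)" for u v
    by (simp add: jordan_product_def K_averaging_l[of u v] K_averaging_r[of v u])
qed

text \<open>
  Both dialgebra products are sent by \<open>K\<close> to the product of \<open>A\<close>, which erases the difference
  between \<open>\<turnstile>\<close> and \<open>\<stileturn>\<close> inside an acting letter; what remains are the bimodule axioms.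
\<close>

lemma (in hom_associative_relative_averaging) hom_associative_dialgebra_averaging:
  "hom_associative_dialgebra scaleV (averaging_vd l K) (averaging_dv r K) \<beta>"
proof (rule hom_associative_dialgebra.intro)
  show "bilinear_map scaleV scaleV scaleV (averaging_vd l K)"
    using bilinear_map_compose_left[OF bilinear_l linear_K]
    by (simp add: averaging_vd_def[abs_def])
  show "bilinear_map scaleV scaleV scaleV (averaging_dv r K)"
    using bilinear_map_flip[OF bilinear_map_compose_left[OF bilinear_r linear_K]]
    by (simp add: averaging_dv_def[abs_def])
qed (simp_all add: averaging_vd_def averaging_dv_def linear_beta beta_l beta_r K_beta
    K_averaging_l[symmetric] K_averaging_r[symmetric] l_mul r_mul l_r)

text \<open>
  The Jordan counterpart: since \<open>K (\<pi> (K u) v) = K u \<circ> K v\<close>, a vector that acts through \<open>K\<close>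
  may be replaced by an element of \<open>A\<close>, and the identities of a Hom-Jordan dialgebra turn into the
  axioms of a Hom-Jordan module.
\<close>

lemma (in hom_jordan_relative_averaging) hom_jordan_dialgebra_averaging:
  "hom_jordan_dialgebra scaleV (\<lambda>u v. \<pi> (K u) v) \<beta>"
proof (rule hom_jordan_dialgebra.intro)
  show "bilinear_map scaleV scaleV scaleV (\<lambda>u v. \<pi> (K u) v)"
    using bilinear_pi linear_K by (rule bilinear_map_compose_left)
  show "Vector_Spaces.linear scaleV scaleV \<beta>"
    by (rule linear_beta)
  show "\<beta> (\<pi> (K u) v) = \<pi> (K (\<beta> u)) (\<beta> v)" for u v
    by (simp add: beta_pi K_beta)
  \<comment> \<open>The averaging condition at letters whose membership in the image of \<open>K\<close> is hidden
    once \<open>K\<close> has been pushed inwards.\<close>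
  have K_averaging_product: "K (\<pi> (K u \<circ>\<^sub>j K v) w) = (K u \<circ>\<^sub>j K v) \<circ>\<^sub>j K w" for u v w
    using K_averaging[of "\<pi> (K u) v" w] by (simp add: K_averaging)
  have K_averaging_twist: "K (\<pi> (\<alpha> (K u)) w) = \<alpha> (K u) \<circ>\<^sub>j K w" for u w
    using K_averaging[of "\<beta> u" w] by (simp add: K_beta)
  note act_simps = K_averaging[symmetric] K_averaging_product K_averaging_twist
    K_beta beta_pi multiplicative
  show "\<pi> (K (\<pi> (K x1) x2)) x3 = \<pi> (K (\<pi> (K x2) x1)) x3" for x1 x2 x3
    by (simp add: act_simps jmul_commute)
  fix x4 x3 x2 x1
  show "\<pi> (K (\<pi> (K (\<pi> (K x4) x3)) (\<beta> x2))) (\<beta> (\<beta> x1))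
      + \<pi> (K (\<beta> (\<beta> x4))) (\<pi> (K (\<beta> x2)) (\<pi> (K x3) x1))
      + \<pi> (K (\<beta> (\<beta> x3))) (\<pi> (K (\<beta> x2)) (\<pi> (K x4) x1))
    = \<pi> (K (\<beta> (\<pi> (K x4) x3))) (\<pi> (K (\<beta> x2)) (\<beta> x1))
      + \<pi> (K (\<pi> (K (\<beta> x4)) (\<beta> x2))) (\<beta> (\<pi> (K x3) x1))
      + \<pi> (K (\<pi> (K (\<beta> x3)) (\<beta> x2))) (\<beta> (\<pi> (K x4) x1))"
    using module_product[of "K x4" "K x3" "K x2" x1]
    by (simp add: act_simps add_ac)
  show "\<pi> (K (\<beta> (\<beta> x1))) (\<pi> (K (\<pi> (K x4) x3)) (\<beta> x2))
      + \<pi> (K (\<beta> (\<beta> x4))) (\<pi> (K (\<pi> (K x3) x1)) (\<beta> x2))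
      + \<pi> (K (\<beta> (\<beta> x3))) (\<pi> (K (\<pi> (K x4) x1)) (\<beta> x2))
    = \<pi> (K (\<beta> (\<pi> (K x4) x3))) (\<pi> (K (\<beta> x1)) (\<beta> x2))
      + \<pi> (K (\<beta> (\<pi> (K x1) x3))) (\<pi> (K (\<beta> x4)) (\<beta> x2))
      + \<pi> (K (\<beta> (\<pi> (K x4) x1))) (\<pi> (K (\<beta> x3)) (\<beta> x2))"
    using module_cyclic[of "K x1" "K x4" "K x3" x2]
    by (simp add: act_simps jmul_commute add_ac)
qed

theorem theorem3p25:
  fixes scaleA :: "'k::field_char_0 \<Rightarrow> 'a::ab_group_add \<Rightarrow> 'a"
    and mul :: "'a \<Rightarrow> 'a \<Rightarrow> 'a"
    and \<alpha> :: "'a \<Rightarrow> 'a"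
    and scaleV :: "'k \<Rightarrow> 'v::ab_group_add \<Rightarrow> 'v"
    and l r :: "'a \<Rightarrow> 'v \<Rightarrow> 'v"
    and \<beta> :: "'v \<Rightarrow> 'v"
    and K :: "'v \<Rightarrow> 'a"
  assumes "hom_associative_algebra scaleA mul \<alpha>"
    and "hom_associative_bimodule scaleA mul \<alpha> scaleV l r \<beta>"
    and "hom_associative_relative_averaging scaleA mul \<alpha> scaleV l r \<beta> K"
  shows "hom_jordan_algebra scaleA (jordan_product mul) \<alpha> \<and>
    hom_jordan_module scaleA (jordan_product mul) \<alpha> scaleV (\<lambda>x v. l x v + r x v) \<beta> \<and>
    hom_jordan_relative_averaging scaleA (jordan_product mul) \<alpha> scaleV (\<lambda>x v. l x v + r x v) \<beta> K \<and>
    hom_associative_dialgebra scaleV (averaging_vd l K) (averaging_dv r K) \<beta> \<and>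
    hom_jordan_dialgebra scaleV (anti_dicommutator (averaging_vd l K) (averaging_dv r K)) \<beta>"
proof -
  interpret hom_associative_relative_averaging scaleA mul \<alpha> scaleV l r \<beta> K
    by (rule assms(3))
  have "anti_dicommutator (averaging_vd l K) (averaging_dv r K)
      = (\<lambda>u v. l (K u) v + r (K u) v)"
    by (intro ext) (simp add: anti_dicommutator_def averaging_vd_def averaging_dv_def)
  then have "hom_jordan_dialgebra scaleV
      (anti_dicommutator (averaging_vd l K) (averaging_dv r K)) \<beta>"
    using hom_jordan_relative_averaging.hom_jordan_dialgebra_averaging
        [OF hom_jordan_relative_averaging_symmetrised_action]
    by simp
  then show ?thesis
    using hom_jordan_algebra_jordan_product hom_jordan_module_symmetrised_action
      hom_jordan_relative_averaging_symmetrised_action hom_associative_dialgebra_averaging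
    by blast
qed

end
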